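(* Let $G$ be a bipartite graph with $n$ vertices, $m$ edges and (nonempty) vertex classes $A,B$. There exists a bipartite graph $R$ on the same vertex set with $m$ edges and the same vertex classes $A,B$ such that (i) $|d_R(u)-d_R(v)|\le 1$ for all $u,v$ belonging to the same vertex class, and (ii) $|E(G)\,\triangle\,E(R)|\le s_2(G)$. In particular, if $m/|A|$ and $m/|B|$ are integers then $R$ is semiregular.
   Context: For a bipartite graph $G$ with vertex classes $A,B$, $|A|=a$, $|B|=b$, and $m$ edges, define $s_2(G)=\sum_{u\in A}\left|d(u)-\frac{m}{a}\right|+\sum_{u\in B}\left|d(u)-\frac{m}{b}\right|$, where $d(u)$ is the degree of $u$. A bipartite graph is semiregular if vertices in the same vertex class have equal degrees. *)

theory Defs
  imports Complex_Main
begin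

definition simple_graph :: "'a set \<Rightarrow> 'a set set \<Rightarrow> bool" where
  "simple_graph V E \<longleftrightarrow> finite V \<and> (\<forall>e\<in>E. e \<subseteq> V \<and> card e = 2)"

definition bipartite_graph :: "'a set \<Rightarrow> 'a set set \<Rightarrow> 'a set \<Rightarrow> 'a set \<Rightarrow> bool" where
  "bipartite_graph V E A B \<longleftrightarrow>
     simple_graph V E \<and> A \<union> B = V \<and> A \<inter> B = {} \<and>
     (\<forall>e\<in>E. \<exists>u\<in>A. \<exists>v\<in>B. e = {u, v})"

definition degree :: "'a set set \<Rightarrow> 'a \<Rightarrow> nat" where
  "degree E u = card {e \<in> E. u \<in> e}"

definition s2 :: "'a set set \<Rightarrow> 'a set \<Rightarrow> 'a set \<Rightarrow> real" where
  "s2 E A B =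
     (\<Sum>u\<in>A. \<bar>real (degree E u) - real (card E) / real (card A)\<bar>) +
     (\<Sum>u\<in>B. \<bar>real (degree E u) - real (card E) / real (card B)\<bar>)"

definition semiregular :: "'a set set \<Rightarrow> 'a set \<Rightarrow> 'a set \<Rightarrow> bool" where
  "semiregular E A B \<longleftrightarrow>
     (\<forall>u\<in>A. \<forall>v\<in>A. degree E u = degree E v) \<and>
     (\<forall>u\<in>B. \<forall>v\<in>B. degree E u = degree E v)"

end

theory Submission
  imports Defs
begin

text \<open>
  Replacing an edge \<open>{u, v}\<close> by \<open>{w, v}\<close> with \<open>u, w\<close> in the same class changes no degree in the
  other class, so the two classes can be balanced one after the other. With \<open>k = m div a\<close>, class \<open>A\<close>
  is balanced by \<open>c = max P N\<close> such moves, where \<open>P\<close> is the total excess of its degrees over \<open>k + 1\<close>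
  and \<open>N\<close> their total deficit below \<open>k\<close>. As \<open>k \<le> m/a \<le> k + 1\<close> and the signed deviations from
  \<open>m/a\<close> cancel, \<open>2P\<close> and \<open>2N\<close> are at most the \<open>A\<close>-part of \<open>s\<^sub>2\<close>, while each move costs 2.
\<close>

section \<open>Edges and degree sums of bipartite graphs\<close>

lemma bipartite_graph_commute: "bipartite_graph V E A B \<longleftrightarrow> bipartite_graph V E B A"
proof -
  have "(\<exists>u\<in>A. \<exists>v\<in>B. e = {u, v}) \<longleftrightarrow> (\<exists>u\<in>B. \<exists>v\<in>A. e = {u, v})" for e
    by (blast intro: insert_commute)
  then show ?thesis
    unfolding bipartite_graph_def by (simp add: Int_commute Un_commute)
qed

lemma bipartite_graph_finite:
  assumes "bipartite_graph V E A B"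
  shows "finite E" "finite A" "finite B"
proof -
  have "E \<subseteq> Pow V" "finite V" "A \<union> B = V"
    using assms by (auto simp: bipartite_graph_def simple_graph_def)
  then show "finite E" "finite A" "finite B"
    by (auto intro: finite_subset)
qed

lemma bipartite_edgeE:
  assumes "bipartite_graph V E A B" "e \<in> E" "u \<in> e" "u \<in> A"
  obtains v where "v \<in> B" "e = {u, v}"
  using assms by (fastforce simp: bipartite_graph_def)

text \<open>Each edge has exactly one endpoint in \<open>A\<close>, so the edge sets at the vertices
  of \<open>A\<close> cover \<open>E\<close> without overlap.\<close>

lemma sum_degree_class:
  assumes G: "bipartite_graph V E A B"
  shows "(\<Sum>u\<in>A. degree E u) = card E"
proof -
  have "E = (\<Union>u\<in>A. {e \<in> E. u \<in> e})"
    using G by (fastforce simp: bipartite_graph_def)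
  moreover have "card (\<Union>u\<in>A. {e \<in> E. u \<in> e}) = (\<Sum>u\<in>A. card {e \<in> E. u \<in> e})"
  proof (rule card_UN_disjoint)
    show "\<forall>i\<in>A. \<forall>j\<in>A. i \<noteq> j \<longrightarrow> {e \<in> E. i \<in> e} \<inter> {e \<in> E. j \<in> e} = {}"
      using G by (fastforce simp: bipartite_graph_def)
  qed (use bipartite_graph_finite[OF G] in auto)
  ultimately show ?thesis
    by (simp add: degree_def)
qed

section \<open>Moving one end of an edge within a class\<close>

lemma exchange_vertex_exists:
  assumes G: "bipartite_graph V E A B" and "u \<in> A" "w \<in> A" and less: "degree E w < degree E u"
  obtains v where "v \<in> B" "{u, v} \<in> E" "{w, v} \<notin> E"
proof (rule ccontr)
  assume "\<not> thesis"
  with that have shared: "{w, v} \<in> E" if "v \<in> B" "{u, v} \<in> E" for v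
    using that by blast
  have AB: "A \<inter> B = {}"
    using G by (simp add: bipartite_graph_def)
  \<comment> \<open>If \<open>w\<close> were joined to every neighbour of \<open>u\<close>, trading
    \<open>u\<close> for \<open>w\<close> would inject the edges at \<open>u\<close> into those at
    \<open>w\<close>, against \<open>less\<close>.\<close>
  let ?f = "\<lambda>e. insert w (e - {u})"
  have f: "\<exists>v\<in>B. e = {u, v} \<and> ?f e = {w, v}" if e: "e \<in> E" "u \<in> e" for e
  proof -
    obtain v where "v \<in> B" "e = {u, v}"
      using bipartite_edgeE[OF G e \<open>u \<in> A\<close>] .
    moreover from this have "v \<noteq> u"
      using AB \<open>u \<in> A\<close> by blast
    ultimately show ?thesis
      by auto
  qed
  have "inj_on ?f {e \<in> E. u \<in> e}"
  proof (rule inj_onI)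
    fix d e
    assume "d \<in> {e \<in> E. u \<in> e}" "e \<in> {e \<in> E. u \<in> e}" and eq: "?f d = ?f e"
    then obtain x y where "d = {u, x}" "?f d = {w, x}" "e = {u, y}" "?f e = {w, y}"
      using f[of d] f[of e] by auto
    with eq show "d = e"
      by (metis doubleton_eq_iff)
  qed
  moreover have "?f ` {e \<in> E. u \<in> e} \<subseteq> {e \<in> E. w \<in> e}"
    using f shared by fastforce
  ultimately have "degree E u \<le> degree E w"
    unfolding degree_def using bipartite_graph_finite(1)[OF G] by (intro card_inj_on_le) auto
  with less show False
    by simp
qed

text \<open>A single move. As \<open>{w, v}\<close> is not yet an edge, the number of edges is kept;
  \<open>v\<close> loses one edge and gains one, so the degrees in \<open>B\<close> stay as they
  are.\<close>

lemma exchange_edge: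
  assumes G: "bipartite_graph V E A B" and "u \<in> A" "w \<in> A" and less: "degree E w < degree E u"
  obtains F where "bipartite_graph V F A B" "card F = card E"
    "\<And>v. v \<in> B \<Longrightarrow> degree F v = degree E v"
    "Suc (degree F u) = degree E u" "degree F w = Suc (degree E w)"
    "\<And>x. x \<in> A \<Longrightarrow> x \<noteq> u \<Longrightarrow> x \<noteq> w \<Longrightarrow> degree F x = degree E x"
    "card (sym_diff E F) \<le> 2"
proof -
  obtain v where v: "v \<in> B" "{u, v} \<in> E" "{w, v} \<notin> E"
    using exchange_vertex_exists[OF assms] .
  define F where "F = insert {w, v} (E - {{u, v}})"
  have AB: "A \<inter> B = {}" and fin: "finite E" and "u \<noteq> w"
    using G bipartite_graph_finite(1)[OF G] less by (auto simp: bipartite_graph_def)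
  then have ne: "u \<noteq> v" "w \<noteq> v" "u \<noteq> w"
    using v \<open>u \<in> A\<close> \<open>w \<in> A\<close> by auto
  have card_pos: "card E > 0"
    using v fin card_gt_0_iff by blast
  \<comment> \<open>The additive form avoids truncated subtraction and treats all vertices at once;
    \<open>v\<close> lies in both sets, so its loss and gain cancel.\<close>
  have deg: "degree F x + of_bool (x \<in> {u, v}) = degree E x + of_bool (x \<in> {w, v})" for x
  proof -
    let ?K = "{e \<in> E - {{u, v}}. x \<in> e}"
    have "{e \<in> E. x \<in> e} = (if x \<in> {u, v} then insert {u, v} ?K else ?K)"
      using v by auto
    then have "degree E x = card ?K + of_bool (x \<in> {u, v})"
      using fin by (simp add: degree_def)
    moreover have "{e \<in> F. x \<in> e} = (if x \<in> {w, v} then insert {w, v} ?K else ?K)"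
      by (auto simp: F_def)
    then have "degree F x = card ?K + of_bool (x \<in> {w, v})"
      using fin v by (simp add: degree_def)
    ultimately show ?thesis
      by simp
  qed
  show thesis
  proof (rule that)
    show "bipartite_graph V F A B"
      using G v \<open>w \<in> A\<close> ne by (auto simp: F_def bipartite_graph_def simple_graph_def)
    show "card F = card E"
      using v fin card_pos by (simp add: F_def)
    show "degree F x = degree E x" if "x \<in> B" for x
      proof -
      have "x \<noteq> u" "x \<noteq> w"
        using that AB \<open>u \<in> A\<close> \<open>w \<in> A\<close> by auto
      then show ?thesis
        using deg[of x] by simp
    qed
    show "Suc (degree F u) = degree E u" "degree F w = Suc (degree E w)"
      using deg[of u] deg[of w] ne by simp_all
    show "degree F x = degree E x" if "x \<in> A" "x \<noteq> u" "x \<noteq> w" for x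
      using deg[of x] that AB v by auto
    have "sym_diff E F \<subseteq> {{u, v}, {w, v}}"
      by (auto simp: F_def)
    then have "card (sym_diff E F) \<le> card {{u, v}, {w, v}}"
      by (intro card_mono) auto
    also have "\<dots> \<le> 2"
      by (simp add: card_insert_if)
    finally show "card (sym_diff E F) \<le> 2" .
  qed
qed

section \<open>Balancing one class move by move\<close>

lemma sum_less_of_pointwise:
  fixes f g :: "'a \<Rightarrow> nat"
  assumes "finite S" "\<And>x. x \<in> S \<Longrightarrow> f x \<le> g x" "u \<in> S" "f u < g u"
  shows "sum f S < sum g S"
  using assms by (intro sum_strict_mono_ex1) auto

lemma card_sym_diff_triangle:
  assumes "finite X" "finite Y" "finite Z"
  shows "card (sym_diff X Z) \<le> card (sym_diff X Y) + card (sym_diff Y Z)"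
proof -
  have "card (sym_diff X Z) \<le> card (sym_diff X Y \<union> sym_diff Y Z)"
    using assms by (intro card_mono) auto
  also have "\<dots> \<le> card (sym_diff X Y) + card (sym_diff Y Z)"
    by (rule card_Un_le)
  finally show ?thesis .
qed

text \<open>These are the ends of the next move. It must lower excess and deficit together whenever
  both are positive, so that the maximum of the two, not their sum, counts the moves. If only one is
  positive, the other end still has room: a vertex of degree at least \<open>Suc k\<close> can give
  up an edge without creating a deficit, and one of degree at most \<open>k\<close> can take an edge
  without creating an excess.\<close>

lemma unbalanced_pair:
  fixes d :: "'a \<Rightarrow> nat"
  assumes "finite A" "A \<noteq> {}" and k: "k = sum d A div card A"
    and unbal: "(\<Sum>x\<in>A. d x - Suc k) > 0 \<or> (\<Sum>x\<in>A. k - d x) > 0"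
  obtains u w where "u \<in> A" "w \<in> A" "d w \<le> k" "Suc k \<le> d u"
    "(\<Sum>x\<in>A. d x - Suc k) > 0 \<Longrightarrow> Suc k < d u" "(\<Sum>x\<in>A. k - d x) > 0 \<Longrightarrow> d w < k"
proof -
  have a: "card A > 0"
    using assms by (simp add: card_gt_0_iff)
  have lo: "(\<Sum>x\<in>A. k) \<le> sum d A"
    using k a by simp
  have hi: "sum d A < (\<Sum>x\<in>A. Suc k)"
    using k a dividend_less_times_div[of "card A" "sum d A"] by simp
  have w0: "\<exists>w\<in>A. d w \<le> k"
    using hi sum_mono[of A "\<lambda>_. Suc k" d] by (meson not_less not_less_eq_eq)
  have w1: "\<exists>w\<in>A. d w < k" if "(\<Sum>x\<in>A. k - d x) > 0"
    using that by (metis (no_types, lifting) less_not_refl not_less sum.neutral diff_is_0_eq)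
  have u1: "\<exists>u\<in>A. Suc k < d u" if "(\<Sum>x\<in>A. d x - Suc k) > 0"
    using that by (metis (no_types, lifting) less_not_refl not_less sum.neutral diff_is_0_eq)
  \<comment> \<open>Unlike \<open>hi\<close>, the bound \<open>lo\<close> is not strict, and
    averaging alone would allow all degrees to equal \<open>k\<close>. Imbalance rules this out:
    with all degrees at most \<open>k\<close> the excess vanishes, so some degree is below
    \<open>k\<close>, which pushes the sum below \<open>lo\<close>.\<close>
  have u0: "\<exists>u\<in>A. Suc k \<le> d u"
  proof (rule ccontr)
    assume "\<not> ?thesis"
    then have le: "d x \<le> k" if "x \<in> A" for x
      using that by (meson not_less_eq_eq)
    then have "(\<Sum>x\<in>A. d x - Suc k) = 0"
      by (simp add: le_SucI)
    then obtain w where "w \<in> A" "d w < k"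
      using unbal w1 by auto
    then have "sum d A < (\<Sum>x\<in>A. k)"
      using le \<open>finite A\<close> by (intro sum_less_of_pointwise)
    with lo show False
      by simp
  qed
  obtain u where u: "u \<in> A" "Suc k \<le> d u" "(\<Sum>x\<in>A. d x - Suc k) > 0 \<Longrightarrow> Suc k < d u"
    using u0 u1 by (metis less_imp_le)
  obtain w where w: "w \<in> A" "d w \<le> k" "(\<Sum>x\<in>A. k - d x) > 0 \<Longrightarrow> d w < k"
    using w0 w1 by (metis less_imp_le)
  show thesis
    by (rule that[OF u(1) w(1,2) u(2,3) w(3)])
qed

text \<open>Induction on the number \<open>c\<close> of available moves: each move lowers every
  positive total by at least one and leaves a zero total at zero. The quotient \<open>k\<close>
  survives because moves preserve the number of edges.\<close>

lemma balance_class_moves: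
  assumes "bipartite_graph V E A B" "A \<noteq> {}" "k = card E div card A"
    "(\<Sum>x\<in>A. degree E x - Suc k) \<le> c" "(\<Sum>x\<in>A. k - degree E x) \<le> c"
  shows "\<exists>R. bipartite_graph V R A B \<and> card R = card E \<and> (\<forall>v\<in>B. degree R v = degree E v) \<and>
    (\<forall>u\<in>A. k \<le> degree R u \<and> degree R u \<le> Suc k) \<and> card (sym_diff E R) \<le> 2 * c"
  using assms
proof (induction c arbitrary: E)
  case 0
  have "finite A"
    using bipartite_graph_finite[OF 0(1)] by simp
  then have "\<forall>u\<in>A. k \<le> degree E u \<and> degree E u \<le> Suc k"
    using 0 by auto
  then show ?case
    using 0 by (intro exI[of _ E]) auto
next
  case (Suc c)
  note G = Suc.prems(1)
  note fin = bipartite_graph_finite[OF G]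
  note excess = Suc.prems(4) and deficit = Suc.prems(5)
  show ?case
  proof (cases "(\<Sum>x\<in>A. degree E x - Suc k) = 0 \<and> (\<Sum>x\<in>A. k - degree E x) = 0")
    case True
    then show ?thesis
      using Suc.IH[OF G Suc.prems(2,3)] by fastforce
  next
    case False
    then have unbal: "(\<Sum>x\<in>A. degree E x - Suc k) > 0 \<or> (\<Sum>x\<in>A. k - degree E x) > 0"
      by linarith
    have k: "k = sum (degree E) A div card A"
      using Suc.prems(3) sum_degree_class[OF G] by simp
    obtain u w where uw: "u \<in> A" "w \<in> A" "degree E w \<le> k" "Suc k \<le> degree E u"
      and u1: "(\<Sum>x\<in>A. degree E x - Suc k) > 0 \<Longrightarrow> Suc k < degree E u"
      and w1: "(\<Sum>x\<in>A. k - degree E x) > 0 \<Longrightarrow> degree E w < k"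
      using unbalanced_pair[OF fin(2) \<open>A \<noteq> {}\<close> k unbal] by blast
    have "degree E w < degree E u"
      using uw by linarith
    from exchange_edge[OF G uw(1,2) this] obtain F
      where F: "bipartite_graph V F A B" "card F = card E"
        and FB: "\<And>v. v \<in> B \<Longrightarrow> degree F v = degree E v"
        and Fu: "Suc (degree F u) = degree E u" and Fw: "degree F w = Suc (degree E w)"
        and Fx: "\<And>x. x \<in> A \<Longrightarrow> x \<noteq> u \<Longrightarrow> x \<noteq> w \<Longrightarrow> degree F x = degree E x"
        and EF: "card (sym_diff E F) \<le> 2"
      by blast
    \<comment> \<open>No vertex gets worse: \<open>u\<close> starts at \<open>Suc k\<close> or more
      and so stays at least \<open>k\<close>, while \<open>w\<close> starts at \<open>k\<close> or
      less and so stays at most \<open>Suc k\<close>.\<close>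
    have le: "degree F x - Suc k \<le> degree E x - Suc k" "k - degree F x \<le> k - degree E x"
      if "x \<in> A" for x
      using Fu Fw Fx[OF that] uw by (cases "x = u"; cases "x = w"; simp)+
    have "(\<Sum>x\<in>A. degree F x - Suc k) \<le> c"
    proof (cases "(\<Sum>x\<in>A. degree E x - Suc k) > 0")
      case True
      then have "(\<Sum>x\<in>A. degree F x - Suc k) < (\<Sum>x\<in>A. degree E x - Suc k)"
        using u1 Fu uw(1) fin(2) le by (intro sum_less_of_pointwise[where u = u]) auto
      then show ?thesis
        using excess by simp
    next
      case False
      then show ?thesis
        using sum_mono[of A "\<lambda>x. degree F x - Suc k" "\<lambda>x. degree E x - Suc k"] le by auto
    qed
    moreover have "(\<Sum>x\<in>A. k - degree F x) \<le> c"
    proof (cases "(\<Sum>x\<in>A. k - degree E x) > 0")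
      case True
      then have "(\<Sum>x\<in>A. k - degree F x) < (\<Sum>x\<in>A. k - degree E x)"
        using w1 Fw uw(2) fin(2) le by (intro sum_less_of_pointwise[where u = w]) auto
      then show ?thesis
        using deficit by simp
    next
      case False
      then show ?thesis
        using sum_mono[of A "\<lambda>x. k - degree F x" "\<lambda>x. k - degree E x"] le by auto
    qed
    moreover have "k = card F div card A"
      using F(2) Suc.prems(3) by simp
    ultimately obtain R where R: "bipartite_graph V R A B" "card R = card F"
      "\<forall>v\<in>B. degree R v = degree F v" "\<forall>u\<in>A. k \<le> degree R u \<and> degree R u \<le> Suc k"
      "card (sym_diff F R) \<le> 2 * c"
      using Suc.IH[OF F(1) \<open>A \<noteq> {}\<close>] by blast
    have "card (sym_diff E R) \<le> 2 * Suc c"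
      using card_sym_diff_triangle[of E F R] EF R(5) bipartite_graph_finite(1)[OF G]
        bipartite_graph_finite(1)[OF F(1)] bipartite_graph_finite(1)[OF R(1)] by simp
    then show ?thesis
      using R F(2) FB by (intro exI[of _ R]) auto
  qed
qed

section \<open>Number of moves against deviation from the mean\<close>

lemma excess_deficit_le_deviation:
  fixes d :: "'a \<Rightarrow> nat"
  assumes "finite A" "A \<noteq> {}" and m: "sum d A = m" and k: "k = m div card A"
  defines "s \<equiv> \<Sum>x\<in>A. \<bar>real (d x) - real m / real (card A)\<bar>"
  shows "2 * real (\<Sum>x\<in>A. d x - Suc k) \<le> s" "2 * real (\<Sum>x\<in>A. k - d x) \<le> s"
proof -
  have a: "card A > 0"
    using assms(1,2) by (simp add: card_gt_0_iff)
  let ?\<mu> = "real m / real (card A)"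
  have "k * card A \<le> m" "m \<le> Suc k * card A"
    using k a dividend_less_times_div[of "card A" m] by (simp_all add: mult.commute less_imp_le)
  then have "real k * real (card A) \<le> real m" "real m \<le> real (Suc k) * real (card A)"
    unfolding of_nat_mult[symmetric] by (simp_all only: of_nat_le_iff)
  then have \<mu>: "real k \<le> ?\<mu>" "?\<mu> \<le> real (Suc k)"
    using a by (simp_all add: field_simps)
  have "(\<Sum>x\<in>A. real (d x) - ?\<mu>) = real (sum d A) - real m"
    using a by (simp add: sum_subtractf)
  then have zero: "(\<Sum>x\<in>A. real (d x) - ?\<mu>) = 0"
    using m by simp
  have "2 * real (\<Sum>x\<in>A. d x - Suc k) = (\<Sum>x\<in>A. 2 * real (d x - Suc k))"
    by (simp add: sum_distrib_left)
  \<comment> \<open>The excess over \<open>Suc k\<close> is at most the positive part of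
    \<open>t = d x - ?\<mu>\<close>, and twice that part is \<open>\<bar>t\<bar> + t\<close>; the
    signed terms then sum to zero.\<close>
  also have "\<dots> \<le> (\<Sum>x\<in>A. \<bar>real (d x) - ?\<mu>\<bar> + (real (d x) - ?\<mu>))"
    using \<mu> by (intro sum_mono) (auto simp: of_nat_diff_if)
  also have "\<dots> = s"
    using zero by (simp add: sum.distrib s_def)
  finally show "2 * real (\<Sum>x\<in>A. d x - Suc k) \<le> s" .
  have "2 * real (\<Sum>x\<in>A. k - d x) = (\<Sum>x\<in>A. 2 * real (k - d x))"
    by (simp add: sum_distrib_left)
  \<comment> \<open>Dually, twice the negative part of \<open>t\<close> is
    \<open>\<bar>t\<bar> - t\<close>, and it bounds the deficit below \<open>k\<close>.\<close>
  also have "\<dots> \<le> (\<Sum>x\<in>A. \<bar>real (d x) - ?\<mu>\<bar> - (real (d x) - ?\<mu>))"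
    using \<mu> by (intro sum_mono) (auto simp: of_nat_diff_if)
  also have "\<dots> = s"
    using zero by (simp add: sum_subtractf s_def)
  finally show "2 * real (\<Sum>x\<in>A. k - d x) \<le> s" .
qed

lemma balance_class:
  assumes G: "bipartite_graph V E A B" and "A \<noteq> {}"
  obtains R where "bipartite_graph V R A B" "card R = card E"
    "\<And>v. v \<in> B \<Longrightarrow> degree R v = degree E v"
    "\<And>u v. u \<in> A \<Longrightarrow> v \<in> A \<Longrightarrow> \<bar>int (degree R u) - int (degree R v)\<bar> \<le> 1"
    "real (card (sym_diff E R)) \<le> (\<Sum>u\<in>A. \<bar>real (degree E u) - real (card E) / real (card A)\<bar>)"
    "\<And>u v. real (card E) / real (card A) \<in> \<int> \<Longrightarrow> u \<in> A \<Longrightarrow> v \<in> A \<Longrightarrow> degree R u = degree R v"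
proof -
  define k where "k = card E div card A"
  define P where "P = (\<Sum>x\<in>A. degree E x - Suc k)"
  define N where "N = (\<Sum>x\<in>A. k - degree E x)"
  let ?s = "\<Sum>u\<in>A. \<bar>real (degree E u) - real (card E) / real (card A)\<bar>"
  note fin = bipartite_graph_finite[OF G]
  have "2 * real P \<le> ?s" "2 * real N \<le> ?s"
    using excess_deficit_le_deviation[OF fin(2) \<open>A \<noteq> {}\<close> sum_degree_class[OF G] k_def]
    by (simp_all only: P_def N_def)
  then have c: "2 * real (max P N) \<le> ?s"
    by (simp add: max_def)
  obtain R where R: "bipartite_graph V R A B" "card R = card E"
    "\<forall>v\<in>B. degree R v = degree E v" "\<forall>u\<in>A. k \<le> degree R u \<and> degree R u \<le> Suc k"
    "card (sym_diff E R) \<le> 2 * max P N"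
    using balance_class_moves[OF G \<open>A \<noteq> {}\<close> k_def, of "max P N"] by (auto simp: P_def N_def)
  \<comment> \<open>For an integral mean, \<open>k\<close> is the mean itself. All degrees are at
    least \<open>k\<close>, so a single larger one would make the degree sum exceed
    \<open>card E\<close>.\<close>
  have regular: "degree R u = k" if int: "real (card E) / real (card A) \<in> \<int>" and "u \<in> A" for u
  proof (rule ccontr)
    assume "degree R u \<noteq> k"
    then have "(\<Sum>x\<in>A. k) < (\<Sum>x\<in>A. degree R x)"
      using R(4) \<open>u \<in> A\<close> fin(2) by (intro sum_less_of_pointwise[where u = u]) auto
    moreover have "card A dvd card E"
    proof -
      have "card A \<noteq> 0"
        using fin(2) \<open>A \<noteq> {}\<close> by simp
      obtain z where z: "real (card E) / real (card A) = of_int z"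
        using int by (elim Ints_cases)
      then have "real_of_int (int (card E)) = real_of_int (z * int (card A))"
        using \<open>card A \<noteq> 0\<close> by (simp add: field_simps)
      then have "int (card A) dvd int (card E)"
        by (metis dvd_triv_right of_int_eq_iff)
      then show ?thesis
        by simp
    qed
    ultimately show False
      using sum_degree_class[OF R(1)] R(2) by (simp add: k_def)
  qed
  show thesis
  proof (rule that)
    show "\<bar>int (degree R u) - int (degree R v)\<bar> \<le> 1" if "u \<in> A" "v \<in> A" for u v
    proof -
      have "k \<le> degree R u" "degree R u \<le> Suc k" "k \<le> degree R v" "degree R v \<le> Suc k"
        using R(4) that by auto
      then show ?thesis
        by linarith
    qed
    have "real (card (sym_diff E R)) \<le> real (2 * max P N)"
      using R(5) of_nat_le_iff by blast
    then show "real (card (sym_diff E R)) \<le> ?s"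
      using c by simp
  qed (use R regular in auto)
qed

section \<open>Balancing both classes in turn\<close>

theorem theorem2:
  fixes V A B :: "'a set" and E :: "'a set set" and n m :: nat
  assumes "bipartite_graph V E A B"
    and "card V = n" and "card E = m"
    and "A \<noteq> {}" and "B \<noteq> {}"
  shows "\<exists>R :: 'a set set.
    bipartite_graph V R A B \<and> card R = m \<and>
    (\<forall>X\<in>{A, B}. \<forall>u\<in>X. \<forall>v\<in>X. \<bar>int (degree R u) - int (degree R v)\<bar> \<le> 1) \<and>
    real (card (sym_diff E R)) \<le> s2 E A B \<and>
    (real m / real (card A) \<in> \<int> \<and> real m / real (card B) \<in> \<int> \<longrightarrow> semiregular R A B)"
proof -
  note G = assms(1)
  obtain F where F: "bipartite_graph V F A B" "card F = card E"
    and FB: "\<And>v. v \<in> B \<Longrightarrow> degree F v = degree E v"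
    and FA: "\<And>u v. u \<in> A \<Longrightarrow> v \<in> A \<Longrightarrow> \<bar>int (degree F u) - int (degree F v)\<bar> \<le> 1"
    and EF: "real (card (sym_diff E F)) \<le>
      (\<Sum>u\<in>A. \<bar>real (degree E u) - real (card E) / real (card A)\<bar>)"
    and regA: "\<And>u v. real (card E) / real (card A) \<in> \<int> \<Longrightarrow> u \<in> A \<Longrightarrow> v \<in> A \<Longrightarrow>
      degree F u = degree F v"
    using balance_class[OF G \<open>A \<noteq> {}\<close>] by blast
  have "bipartite_graph V F B A"
    using F(1) bipartite_graph_commute by blast
  \<comment> \<open>The second round starts from \<open>F\<close> with the classes swapped, so the
    degrees already balanced in \<open>A\<close> are kept.\<close>
  from balance_class[OF this \<open>B \<noteq> {}\<close>] obtain R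
    where R: "bipartite_graph V R B A" "card R = card F"
    and RA: "\<And>v. v \<in> A \<Longrightarrow> degree R v = degree F v"
    and RB: "\<And>u v. u \<in> B \<Longrightarrow> v \<in> B \<Longrightarrow> \<bar>int (degree R u) - int (degree R v)\<bar> \<le> 1"
    and FR: "real (card (sym_diff F R)) \<le>
      (\<Sum>u\<in>B. \<bar>real (degree F u) - real (card F) / real (card B)\<bar>)"
    and regB: "\<And>u v. real (card F) / real (card B) \<in> \<int> \<Longrightarrow> u \<in> B \<Longrightarrow> v \<in> B \<Longrightarrow>
      degree R u = degree R v"
    by blast
  have "card (sym_diff E R) \<le> card (sym_diff E F) + card (sym_diff F R)"
    by (intro card_sym_diff_triangle bipartite_graph_finite(1)[OF G]
        bipartite_graph_finite(1)[OF F(1)] bipartite_graph_finite(1)[OF R(1)])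
  then have "real (card (sym_diff E R)) \<le> real (card (sym_diff E F)) + real (card (sym_diff F R))"
    unfolding of_nat_add[symmetric] of_nat_le_iff .
  \<comment> \<open>The first round changed neither the degrees in \<open>B\<close> nor the number
    of edges, so the cost of the second is bounded by the \<open>B\<close>-part of \<open>s2\<close>
    for \<open>E\<close> itself.\<close>
  also have "\<dots> \<le> s2 E A B"
    using EF FR FB F(2) by (simp add: s2_def)
  finally have dist: "real (card (sym_diff E R)) \<le> s2 E A B" .
  have "semiregular R A B" if "real m / real (card A) \<in> \<int>" "real m / real (card B) \<in> \<int>"
    unfolding semiregular_def
  proof (intro conjI ballI)
    show "degree R u = degree R v" if "u \<in> A" "v \<in> A" for u v
      using regA[OF _ that] RA that \<open>real m / real (card A) \<in> \<int>\<close> \<open>card E = m\<close> by simp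
    show "degree R u = degree R v" if "u \<in> B" "v \<in> B" for u v
      using regB[OF _ that] \<open>real m / real (card B) \<in> \<int>\<close> F(2) \<open>card E = m\<close> by simp
  qed
  moreover have "bipartite_graph V R A B"
    using R(1) bipartite_graph_commute by blast
  moreover have "card R = m"
    using R(2) F(2) \<open>card E = m\<close> by simp
  moreover have "\<forall>X\<in>{A, B}. \<forall>u\<in>X. \<forall>v\<in>X. \<bar>int (degree R u) - int (degree R v)\<bar> \<le> 1"
    using FA RA RB by simp
  ultimately show ?thesis
    using dist by blast
qed

end
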